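(* Let $\mathbf d_n,\mathbf p_n,\mathbf q_n,\mathbf r_n,\mathbf v_n,\mathbf j_n\in\mathbb Z^{12}$ ($n\ge0$) be the sequences of d-vectors determined by the system of $(\max,+)$ equations (for $n\ge 0$, with $\max$ taken componentwise) $$\begin{aligned} \mathbf d_{n+7}+\mathbf d_n&=\max(\mathbf d_{n+5}+\mathbf d_{n+2},\ \mathbf p_n),\\ \mathbf p_{n+1}+\mathbf p_n&=\max(\mathbf d_{n+2}+\mathbf d_{n+3}+\mathbf d_{n+5}+\mathbf d_{n+6},\ \mathbf q_n+\mathbf d_{n+1}+\mathbf d_{n+7}),\\ \mathbf q_{n+1}+\mathbf q_n&=\max(\mathbf d_{n+3}+\mathbf d_{n+4}+\mathbf d_{n+5}+\mathbf d_{n+6},\ \mathbf r_n+\mathbf p_{n+1}),\\ \mathbf r_{n+1}+\mathbf r_n&=\max(\mathbf d_{n+4}+2\mathbf d_{n+5}+\mathbf d_{n+6},\ \mathbf v_n+\mathbf j_n+\mathbf q_{n+1}),\\ \mathbf v_{n+1}+\mathbf j_n&=\max(\mathbf d_{n+5}+\mathbf d_{n+6},\ \mathbf r_{n+1}),\\ \mathbf j_{n+1}+\mathbf v_n&=\max(\mathbf d_{n+5}+\mathbf d_{n+6},\ \mathbf r_{n+1}), \end{aligned}$$ with initial data given by $$(\mathbf r_0\ \mathbf v_0\ \mathbf j_0\ \mathbf d_0\ \mathbf d_1\ \mathbf d_2\ \mathbf d_3\ \mathbf d_4\ \mathbf d_5\ \mathbf d_6\ \mathbf p_0\ \mathbf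 q_0)=-I,$$ where $I$ is the $12\times12$ identity matrix. Let $\mathcal T$ be the shift operator $n\mapsto n+1$. Then each of the sequences $\mathbf w_n=\mathbf d_n,\mathbf p_n,\mathbf q_n,\mathbf r_n,\mathbf v_n,\mathbf j_n$ satisfies the linear difference equation $$(\mathcal T^6-1)(\mathcal T^5-1)(\mathcal T-1)\,\mathbf w_n=0,$$ and, with $\mathbf a=(2,1,1,1,1,1,1,1,1,1,2,2)^T$, as $n\to\infty$, $$\mathbf d_n=\tfrac{n^2}{60}\mathbf a+O(n),\quad \mathbf v_n=\tfrac{n^2}{60}\mathbf a+O(n),\quad \mathbf j_n=\tfrac{n^2}{60}\mathbf a+O(n),$$ $$\mathbf p_n=\tfrac{n^2}{30}\mathbf a+O(n),\quad \mathbf q_n=\tfrac{n^2}{30}\mathbf a+O(n),\quad \mathbf r_n=\tfrac{n^2}{30}\mathbf a+O(n).$$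
   Context: The vectors $\mathbf d_n,\mathbf p_n,\mathbf q_n,\mathbf r_n,\mathbf v_n,\mathbf j_n$ are the denominator exponent vectors (d-vectors) of the cluster variables $\tau_n,\chi_n,\eta_{1,n},\xi_{1,n},r_n,s_n$, respectively, generated by iterating the cluster map obtained by Laurentification of the deformed type $D_6$ map, written as Laurent polynomials in the initial unfrozen variables $(\xi_{1,0},r_0,s_0,\tau_0,\dots,\tau_6,\chi_0,\eta_{1,0})$; the coordinates of the vectors are ordered accordingly. For the claim it suffices to regard them as the sequences determined by the stated $(\max,+)$ system and initial data. $O(n)$ is understood componentwise. *)

theory Defs
  imports "HOL-Analysis.Analysis" "HOL-Library.Landau_Symbols" "HOL-Library.Numeral_Type"
begin

(* The library's lattice operations on vectors are only available over ordered Euclidean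
   spaces, which excludes integer entries. *)
definition vmax :: "int ^ 'n \<Rightarrow> int ^ 'n \<Rightarrow> int ^ 'n" where
  "vmax x y = (\<chi> i. max (x $ i) (y $ i))"

definition shift :: "(nat \<Rightarrow> 'a) \<Rightarrow> nat \<Rightarrow> 'a" where
  "shift w = (\<lambda>n. w (n + 1))"

(* The operator T^k - 1, where T is the shift. *)
definition shift_pow_minus_1 :: "nat \<Rightarrow> (nat \<Rightarrow> 'a::ab_group_add) \<Rightarrow> nat \<Rightarrow> 'a" where
  "shift_pow_minus_1 k w = (\<lambda>n. (shift ^^ k) w n - w n)"

end

theory Submission
  imports Defs
begin

text \<open>
  In each of the equations let \<open>y\<close> be the first argument of the maximum minus the second. The five
  differences \<open>y\<^sub>1, \<dots>, y\<^sub>5\<close> (the last two equations share one) evolve autonomously, by a tropical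
  Y-system of finite type, and Zamolodchikov periodicity makes them 6-periodic; for the given
  initial data this is a finite computation in each coordinate. Since
  \<open>(T\<^sup>5 - 1) (T\<^sup>2 - 1) d = max 0 (- y\<^sub>1)\<close>, applying \<open>T\<^sup>4 + T\<^sup>2 + 1\<close> shows that
  \<open>(T\<^sup>6 - 1) (T\<^sup>5 - 1) d\<close> is a constant, namely the coordinate of \<open>a\<close>. The other sequences are
  linear combinations of shifts of \<open>d\<close> and of the periodic \<open>y\<close>'s, up to the constant \<open>v - j\<close>.
\<close>

section \<open>Sequences with constant second difference of steps 6 and 5\<close>

text \<open>This is \<open>(T^6 - 1) (T^5 - 1) w\<close> for the shift \<open>T\<close>. If it is
  constant, the factor \<open>T - 1\<close> annihilates it, and the constant also determines the
  leading coefficient of \<open>w\<close>.\<close>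

definition diff65 :: "(nat \<Rightarrow> 'a::ab_group_add) \<Rightarrow> nat \<Rightarrow> 'a" where
  "diff65 w n = w (n + 11) - w (n + 6) - w (n + 5) + w n"

lemma shift_funpow: "(shift ^^ k) w n = w (n + k)"
  by (induction k arbitrary: n) (auto simp: shift_def)

lemma shift_pow_minus_1_eq: "shift_pow_minus_1 k w n = w (n + k) - w n"
  by (simp add: shift_pow_minus_1_def shift_funpow)

lemma shift_pow_minus_1_diff65:
  "shift_pow_minus_1 6 (shift_pow_minus_1 5 (shift_pow_minus_1 1 w)) n = diff65 w (n + 1) - diff65 w n"
  by (simp add: shift_pow_minus_1_eq diff65_def algebra_simps eval_nat_numeral)

lemma periodic_shift_mult:
  fixes g :: "nat \<Rightarrow> 'a"
  assumes "\<And>n. g (n + k) = g n"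
  shows "g (n + k * m) = g n"
proof (induction m)
  case (Suc m)
  have "g (n + k * Suc m) = g (n + k * m + k)" by (simp add: algebra_simps)
  then show ?case using Suc assms by simp
qed simp

lemma periodic_mod:
  fixes g :: "nat \<Rightarrow> 'a"
  assumes "\<And>n. g (n + k) = g n"
  shows "g n = g (n mod k)"
  using periodic_shift_mult[of g k "n mod k" "n div k", OF assms] by simp

section \<open>Growth of sequences with periodic differences\<close>

lemma periodic_bounded:
  fixes g :: "nat \<Rightarrow> real"
  assumes "\<And>n. g (n + k) = g n" "k > 0"
  obtains B where "B \<ge> 0" "\<And>n. \<bar>g n\<bar> \<le> B"
proof
  show "(\<Sum>i<k. \<bar>g i\<bar>) \<ge> 0" by (simp add: sum_nonneg)
  show "\<bar>g n\<bar> \<le> (\<Sum>i<k. \<bar>g i\<bar>)" for n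
    using member_le_sum[of "n mod k" "{..<k}" "\<lambda>i. \<bar>g i\<bar>"] periodic_mod[of g k n, OF assms(1)] \<open>k > 0\<close>
    by simp
qed

text \<open>Descending in steps of \<open>k\<close> reaches one of the first \<open>k\<close> values
  after at most \<open>n\<close> steps, each costing at most \<open>B\<close>. Hence
  \<open>f n\<close> is at most \<open>C + B * n\<close> in absolute value, where \<open>C\<close>
  bounds those first values.\<close>

lemma bounded_increments_bigo:
  fixes f :: "nat \<Rightarrow> real"
  assumes "\<And>n. \<bar>f (n + k) - f n\<bar> \<le> B" "B \<ge> 0" "k > 0"
  shows "f \<in> O(\<lambda>n. real n)"
proof -
  define C where "C = (\<Sum>i<k. \<bar>f i\<bar>)"
  have bound: "\<bar>f n\<bar> \<le> C + B * real n" for n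
  proof (induction n rule: less_induct)
    case (less n)
    show ?case
    proof (cases "n < k")
      case True
      then have "\<bar>f n\<bar> \<le> C"
        unfolding C_def using member_le_sum[of n "{..<k}" "\<lambda>i. \<bar>f i\<bar>"] by simp
      then show ?thesis using \<open>B \<ge> 0\<close> by (smt (verit) mult_nonneg_nonneg of_nat_0_le_iff)
    next
      case False
      then obtain m where m: "n = m + k" using le_Suc_ex[of k n] by (auto simp: add.commute)
      have "\<bar>f m\<bar> \<le> C + B * real m" using less[of m] m \<open>k > 0\<close> by simp
      moreover have "B * real m + B \<le> B * real n"
        using mult_left_mono[of "real m + 1" "real n" B] m \<open>k > 0\<close> \<open>B \<ge> 0\<close> by (simp add: distrib_left)
      moreover have "\<bar>f n - f m\<bar> \<le> B" using assms(1)[of m] m by simp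
      ultimately show ?thesis by linarith
    qed
  qed
  have "C \<ge> 0" by (simp add: C_def sum_nonneg)
  show ?thesis
  proof (rule bigoI)
    show "\<forall>\<^sub>F n in at_top. norm (f n) \<le> (C + B) * norm (real n)"
      using eventually_ge_at_top[of "1::nat"]
    proof eventually_elim
      case (elim n)
      have "C \<le> C * real n" using elim \<open>C \<ge> 0\<close> by (simp add: mult_le_cancel_left1)
      then show ?case using bound[of n] by (simp add: distrib_right)
    qed
  qed
qed

text \<open>Applying \<open>(T^6 - 1) (T^5 - 1)\<close> to \<open>n^2\<close> gives
  \<open>2 * 6 * 5 = 60\<close>, so subtracting \<open>K * n^2 / 60\<close> leaves a sequence
  \<open>f\<close> with zero second difference. Then \<open>(T^5 - 1) f\<close> is 6-periodic, hence
  bounded, and \<open>f\<close> grows at most linearly.\<close>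

lemma diff65_const_asymptotics:
  fixes w :: "nat \<Rightarrow> int" and K :: int
  assumes "\<And>n. diff65 w n = K"
  shows "(\<lambda>n. real_of_int (w n) - (real n)\<^sup>2 / 60 * real_of_int K) \<in> O(\<lambda>n. real n)"
proof -
  define f where "f n = real_of_int (w n) - (real n)\<^sup>2 / 60 * real_of_int K" for n
  define g where "g n = f (n + 5) - f n" for n
  have "g (n + 6) = g n" for n
  proof -
    have "real_of_int (diff65 w n) = real_of_int K" using assms by simp
    then have "real_of_int (w (n + 11)) - w (n + 6) - w (n + 5) + w n = K"
      by (simp add: diff65_def)
    then show ?thesis
      by (simp add: g_def f_def field_simps power2_eq_square)
  qed
  then obtain B where "B \<ge> 0" "\<And>n. \<bar>g n\<bar> \<le> B" by (metis periodic_bounded zero_less_numeral)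
  then have "f \<in> O(\<lambda>n. real n)"
    using bounded_increments_bigo[of f 5 B] by (simp add: g_def)
  then show ?thesis by (simp add: f_def[abs_def])
qed

section \<open>The tropical Y-system\<close>

text \<open>One step of the tropical Y-system of the D6 diagram with equal values on the two fork
  nodes, whence the factor 2 on \<open>y5\<close>. Each node uses the already updated value of its
  predecessor and the old value of its successor.\<close>

definition ystep :: "int \<times> int \<times> int \<times> int \<times> int \<Rightarrow> int \<times> int \<times> int \<times> int \<times> int" where
  "ystep = (\<lambda>(y1, y2, y3, y4, y5).
     let z1 = min 0 y2 - y1;
         z2 = min 0 y3 + min 0 z1 - y2;
         z3 = min 0 y4 + min 0 z2 - y3;
         z4 = min 0 z3 + 2 * min 0 y5 - y4;
         z5 = min 0 z4 - y5
     in (z1, z2, z3, z4, z5))"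

text \<open>The Y-variables at time 0 in terms of the twelve initial values, listed in the order of
  the initial data. The local values \<open>d7\<close>, \<open>p1\<close>, \<open>q1\<close>,
  \<open>r1\<close> are the first iterates of the system; the closed form can be evaluated by
  computation.\<close>

definition yinit ::
  "int \<Rightarrow> int \<Rightarrow> int \<Rightarrow> int \<Rightarrow> int \<Rightarrow> int \<Rightarrow>
   int \<Rightarrow> int \<Rightarrow> int \<Rightarrow> int \<Rightarrow> int \<Rightarrow> int \<Rightarrow> int \<times> int \<times> int \<times> int \<times> int" where
  "yinit r0 v0 j0 d0 d1 d2 d3 d4 d5 d6 p0 q0 =
    (let d7 = max (d5 + d2) p0 - d0;
         p1 = max (d2 + d3 + d5 + d6) (q0 + d1 + d7) - p0;
         q1 = max (d3 + d4 + d5 + d6) (r0 + p1) - q0;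
         r1 = max (d4 + 2 * d5 + d6) (v0 + j0 + q1) - r0
     in (d5 + d2 - p0, d2 + d3 + d5 + d6 - (q0 + d1 + d7), d3 + d4 + d5 + d6 - (r0 + p1),
         d4 + 2 * d5 + d6 - (v0 + j0 + q1), d5 + d6 - r1))"

definition neg_y1 :: "int \<times> int \<times> int \<times> int \<times> int \<Rightarrow> nat \<Rightarrow> int" where
  "neg_y1 y n = - min 0 (fst ((ystep ^^ n) y))"

text \<open>The two sums are the values at times 0 and 1 of \<open>T^4 + T^2 + 1\<close> applied to
  \<open>neg_y1 y\<close>. With period 6 this sequence has period 2, so two values determine
  it.\<close>

definition good_y :: "int \<times> int \<times> int \<times> int \<times> int \<Rightarrow> int \<Rightarrow> bool" where
  "good_y y K \<longleftrightarrow> (ystep ^^ 6) y = y \<and>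
     neg_y1 y 0 + neg_y1 y 2 + neg_y1 y 4 = K \<and> neg_y1 y 1 + neg_y1 y 3 + neg_y1 y 5 = K"

text \<open>The twelve cases are the twelve coordinates of the initial data \<open>-I\<close>: in
  each, a single initial value is -1. The constants are the entries of \<open>a\<close>.\<close>

lemma good_y_unit:
  "good_y (yinit (-1) 0 0 0 0 0 0 0 0 0 0 0) 2"
  "good_y (yinit 0 (-1) 0 0 0 0 0 0 0 0 0 0) 1"
  "good_y (yinit 0 0 (-1) 0 0 0 0 0 0 0 0 0) 1"
  "good_y (yinit 0 0 0 (-1) 0 0 0 0 0 0 0 0) 1"
  "good_y (yinit 0 0 0 0 (-1) 0 0 0 0 0 0 0) 1"
  "good_y (yinit 0 0 0 0 0 (-1) 0 0 0 0 0 0) 1"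
  "good_y (yinit 0 0 0 0 0 0 (-1) 0 0 0 0 0) 1"
  "good_y (yinit 0 0 0 0 0 0 0 (-1) 0 0 0 0) 1"
  "good_y (yinit 0 0 0 0 0 0 0 0 (-1) 0 0 0) 1"
  "good_y (yinit 0 0 0 0 0 0 0 0 0 (-1) 0 0) 1"
  "good_y (yinit 0 0 0 0 0 0 0 0 0 0 (-1) 0) 2"
  "good_y (yinit 0 0 0 0 0 0 0 0 0 0 0 (-1)) 2"
  by code_simp+

section \<open>The (max,+) system in one coordinate\<close>

locale tropical_D6 =
  fixes d p q r v j :: "nat \<Rightarrow> int"
  assumes d_eq: "d (n + 7) + d n = max (d (n + 5) + d (n + 2)) (p n)"
    and p_eq: "p (n + 1) + p n =
      max (d (n + 2) + d (n + 3) + d (n + 5) + d (n + 6)) (q n + d (n + 1) + d (n + 7))"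
    and q_eq: "q (n + 1) + q n =
      max (d (n + 3) + d (n + 4) + d (n + 5) + d (n + 6)) (r n + p (n + 1))"
    and r_eq: "r (n + 1) + r n =
      max (d (n + 4) + 2 * d (n + 5) + d (n + 6)) (v n + j n + q (n + 1))"
    and v_eq: "v (n + 1) + j n = max (d (n + 5) + d (n + 6)) (r (n + 1))"
    and j_eq: "j (n + 1) + v n = max (d (n + 5) + d (n + 6)) (r (n + 1))"
begin

definition y1 where "y1 n = d (n + 5) + d (n + 2) - p n"
definition y2 where
  "y2 n = d (n + 2) + d (n + 3) + d (n + 5) + d (n + 6) - (q n + d (n + 1) + d (n + 7))"
definition y3 where "y3 n = d (n + 3) + d (n + 4) + d (n + 5) + d (n + 6) - (r n + p (n + 1))"
definition y4 where "y4 n = d (n + 4) + 2 * d (n + 5) + d (n + 6) - (v n + j n + q (n + 1))"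
definition y5 where "y5 n = d (n + 5) + d (n + 6) - r (n + 1)"

lemmas y_defs = y1_def y2_def y3_def y4_def y5_def

text \<open>This turns each equation of the system into one that expresses \<open>min 0\<close> of a
  Y-variable linearly in the original sequences.\<close>

lemma max_eq_diff: "max x z = x - min 0 (x - z)" for x z :: int
  by simp

lemma min_y1: "min 0 (y1 n) = d (n + 5) + d (n + 2) - d (n + 7) - d n"
  using d_eq[of n] unfolding y_defs max_eq_diff by linarith

lemma min_y2: "min 0 (y2 n) = d (n + 2) + d (n + 3) + d (n + 5) + d (n + 6) - p (n + 1) - p n"
  using p_eq[of n] unfolding y_defs max_eq_diff by linarith

lemma min_y3: "min 0 (y3 n) = d (n + 3) + d (n + 4) + d (n + 5) + d (n + 6) - q (n + 1) - q n"
  using q_eq[of n] unfolding y_defs max_eq_diff by linarith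

lemma min_y4: "min 0 (y4 n) = d (n + 4) + 2 * d (n + 5) + d (n + 6) - r (n + 1) - r n"
  using r_eq[of n] unfolding y_defs max_eq_diff by linarith

text \<open>Adding the equations for \<open>v\<close> and \<open>j\<close> gives an expression in
  \<open>v + j\<close> alone, which is the combination that occurs in \<open>y4\<close>.\<close>

lemma min_y5: "2 * min 0 (y5 n) = 2 * (d (n + 5) + d (n + 6)) - v (n + 1) - v n - j (n + 1) - j n"
proof -
  have "v (n + 1) + j n = d (n + 5) + d (n + 6) - min 0 (y5 n)"
    using v_eq[of n] unfolding y_defs max_eq_diff .
  moreover have "j (n + 1) + v n = d (n + 5) + d (n + 6) - min 0 (y5 n)"
    using j_eq[of n] unfolding y_defs max_eq_diff .
  ultimately show ?thesis by simp
qed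

lemmas min_y = min_y1 min_y2 min_y3 min_y4 min_y5

definition y where "y n = (y1 n, y2 n, y3 n, y4 n, y5 n)"

lemma ystep_y: "ystep (y n) = y (Suc n)"
proof -
  \<comment> \<open>Once each \<open>min 0\<close> is replaced by its linear expression, this and
    the following four relations are linear identities in which no maximum remains.\<close>
  have "min 0 (y2 n) - y1 n = y1 (Suc n)"
    unfolding min_y by (simp add: y_defs eval_nat_numeral)
  moreover have "min 0 (y3 n) + min 0 (y1 (Suc n)) - y2 n = y2 (Suc n)"
    unfolding min_y by (simp add: y_defs eval_nat_numeral)
  moreover have "min 0 (y4 n) + min 0 (y2 (Suc n)) - y3 n = y3 (Suc n)"
    unfolding min_y by (simp add: y_defs eval_nat_numeral)
  moreover have "min 0 (y3 (Suc n)) + 2 * min 0 (y5 n) - y4 n = y4 (Suc n)"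
    unfolding min_y by (simp add: y_defs eval_nat_numeral)
  moreover have "min 0 (y4 (Suc n)) - y5 n = y5 (Suc n)"
    unfolding min_y by (simp add: y_defs eval_nat_numeral)
  ultimately show ?thesis by (simp only: y_def ystep_def Let_def prod.case)
qed

lemma y_funpow: "y n = (ystep ^^ n) (y 0)"
  by (induction n) (simp_all flip: ystep_y)

lemma y_0: "y 0 = yinit (r 0) (v 0) (j 0) (d 0) (d 1) (d 2) (d 3) (d 4) (d 5) (d 6) (p 0) (q 0)"
proof -
  have d7: "max (d 5 + d 2) (p 0) - d 0 = d 7" using d_eq[of 0] by (simp add: numeral_2_eq_2)
  have p1: "max (d 2 + d 3 + d 5 + d 6) (q 0 + d 1 + d 7) - p 0 = p 1"
    using p_eq[of 0] by (simp add: numeral_2_eq_2)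
  have q1: "max (d 3 + d 4 + d 5 + d 6) (r 0 + p 1) - q 0 = q 1" using q_eq[of 0] by simp
  have r1: "max (d 4 + 2 * d 5 + d 6) (v 0 + j 0 + q 1) - r 0 = r 1" using r_eq[of 0] by simp
  show ?thesis
    unfolding yinit_def Let_def d7 p1 q1 r1 by (simp add: y_def y_defs numeral_2_eq_2)
qed

section \<open>Second differences of all six sequences, from periodicity\<close>

context
  fixes K :: int
  assumes good: "good_y (y 0) K"
begin

lemma y_periodic: "y (n + 6) = y n"
proof -
  have "(ystep ^^ 6) (y 0) = y 0" using good by (simp add: good_y_def)
  then show ?thesis using y_funpow[of "n + 6"] y_funpow[of n] by (simp add: funpow_add del: funpow.simps)
qed

lemma y_i_periodic:
  "y1 (n + 6) = y1 n" "y2 (n + 6) = y2 n" "y3 (n + 6) = y3 n" "y4 (n + 6) = y4 n"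
  using y_periodic[of n] by (simp_all add: y_def)

text \<open>A shift by 2 permutes the three terms cyclically because \<open>y1\<close> has period 6.
  The sum therefore has period 2, and its values at 0 and 1 are given by
  \<open>good_y\<close>.\<close>

lemma sum_min_y1: "min 0 (y1 n) + min 0 (y1 (n + 2)) + min 0 (y1 (n + 4)) = - K"
proof -
  define s where "s n = min 0 (y1 n) + min 0 (y1 (n + 2)) + min 0 (y1 (n + 4))" for n
  have "neg_y1 (y 0) m = - min 0 (y1 m)" for m
    unfolding neg_y1_def y_funpow[symmetric] by (simp add: y_def)
  then have "s 0 = - K" "s 1 = - K"
    using good by (simp_all add: good_y_def s_def eval_nat_numeral)
  moreover have "s (n + 2) = s n" for n
    using y_i_periodic(1)[of n] by (simp add: s_def eval_nat_numeral)
  then have "s n = s (n mod 2)" by (rule periodic_mod)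
  moreover have "n mod 2 = 0 \<or> n mod 2 = 1" by auto
  ultimately have "s n = - K" by metis
  then show ?thesis by (simp add: s_def)
qed

text \<open>By \<open>min_y1\<close>, the summands are shifts of
  \<open>- (T^5 - 1) (T^2 - 1) d\<close>, and their sum telescopes since
  \<open>(T^2 - 1) (T^4 + T^2 + 1) = T^6 - 1\<close>.\<close>

lemma diff65_d: "diff65 d n = K"
  using sum_min_y1[of n] by (simp add: min_y diff65_def eval_nat_numeral)

lemma diff65_y:
  "diff65 y1 n = 0" "diff65 y2 n = 0" "diff65 y3 n = 0" "diff65 y4 n = 0"
  using y_i_periodic[of n] y_i_periodic[of "n + 5"] by (simp_all add: diff65_def eval_nat_numeral)

text \<open>Solving \<open>y1_def\<close> for \<open>p\<close> gives two shifts of \<open>d\<close>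
  minus a 6-periodic term, which \<open>diff65\<close> annihilates. The cases of \<open>q\<close>
  and \<open>r\<close> are alike, with net weights \<open>4 - 2\<close> and \<open>4 - 2\<close> in
  units of \<open>K\<close>.\<close>

lemma diff65_p: "diff65 p n = 2 * K"
  using diff65_d[of "n + 5"] diff65_d[of "n + 2"] diff65_y(1)[of n]
  by (simp add: diff65_def y_defs eval_nat_numeral)

lemma diff65_q: "diff65 q n = 2 * K"
  using diff65_d[of "n + 1"] diff65_d[of "n + 2"] diff65_d[of "n + 3"] diff65_d[of "n + 5"]
    diff65_d[of "n + 6"] diff65_d[of "n + 7"] diff65_y(2)[of n]
  by (simp add: diff65_def y_defs eval_nat_numeral)

lemma diff65_r: "diff65 r n = 2 * K"
  using diff65_d[of "n + 3"] diff65_d[of "n + 4"] diff65_d[of "n + 5"] diff65_d[of "n + 6"]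
    diff65_p[of "n + 1"] diff65_y(3)[of n]
  by (simp add: diff65_def y_defs eval_nat_numeral)

text \<open>The equations for \<open>v\<close> and \<open>j\<close> have the same right-hand side,
  so the difference is conserved.\<close>

lemma v_minus_j: "v n - j n = v 0 - j 0"
proof (induction n)
  case (Suc n)
  then show ?case using v_eq[of n] j_eq[of n] by simp
qed simp

text \<open>The definition of \<open>y4\<close> determines only \<open>v + j\<close>, with total
  \<open>4 * K - 2 * K\<close>. The constant difference \<open>v - j\<close> then forces equal
  shares.\<close>

lemma diff65_v_j: "diff65 v n = K" "diff65 j n = K"
proof -
  have "diff65 v n + diff65 j n = 2 * K"
    using diff65_d[of "n + 4"] diff65_d[of "n + 5"] diff65_d[of "n + 6"]
      diff65_q[of "n + 1"] diff65_y(4)[of n]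
    by (simp add: diff65_def y_defs eval_nat_numeral)
  moreover have "diff65 v n = diff65 j n"
    using v_minus_j[of n] v_minus_j[of "n + 5"] v_minus_j[of "n + 6"] v_minus_j[of "n + 11"]
    by (simp add: diff65_def)
  ultimately show "diff65 v n = K" "diff65 j n = K" by simp_all
qed

end

end

section \<open>The coordinates of the d-vectors\<close>

lemma forall_12:
  "(\<forall>i::12. P i) \<longleftrightarrow>
    P 1 \<and> P 2 \<and> P 3 \<and> P 4 \<and> P 5 \<and> P 6 \<and> P 7 \<and> P 8 \<and> P 9 \<and> P 10 \<and> P 11 \<and> P 12"
proof (intro iffI allI)
  fix i :: 12
  assume *: "P 1 \<and> P 2 \<and> P 3 \<and> P 4 \<and> P 5 \<and> P 6 \<and> P 7 \<and> P 8 \<and> P 9 \<and> P 10 \<and> P 11 \<and> P 12"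
  show "P i"
  proof (cases i)
    case (of_int z)
    then have "0 \<le> z" "z < 12" by simp_all
    then have "z \<in> {0, 1, 2, 3, 4, 5, 6, 7, 8, 9, 10, 11}"
      unfolding insert_iff empty_iff by presburger
    \<comment> \<open>The index type \<open>12\<close> is the integers modulo 12, so the last
      coordinate, written 12, is the element 0.\<close>
    moreover have "P 0"
    proof -
      have "(12::12) = 0" by simp
      then show ?thesis using * by metis
    qed
    ultimately show ?thesis using of_int * by auto
  qed
qed blast

lemma vector_12:
  fixes x1 x2 x3 x4 x5 x6 x7 x8 x9 x10 x11 x12 :: "'a::zero"
  defines "w \<equiv> (vector [x1, x2, x3, x4, x5, x6, x7, x8, x9, x10, x11, x12] :: 'a ^ 12)"
  shows "w $ 1 = x1" "w $ 2 = x2" "w $ 3 = x3" "w $ 4 = x4" "w $ 5 = x5" "w $ 6 = x6"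
    "w $ 7 = x7" "w $ 8 = x8" "w $ 9 = x9" "w $ 10 = x10" "w $ 11 = x11" "w $ 12 = x12"
  unfolding w_def vector_def by simp_all

section \<open>Assembling the vector statement from its coordinates\<close>

theorem theorem4p2:
  fixes d p q r v j :: "nat \<Rightarrow> int ^ 12"
    and a :: "real ^ 12"
  assumes "\<And>n. d (n+7) + d n = vmax (d (n+5) + d (n+2)) (p n)"
    and "\<And>n. p (n+1) + p n =
           vmax (d (n+2) + d (n+3) + d (n+5) + d (n+6)) (q n + d (n+1) + d (n+7))"
    and "\<And>n. q (n+1) + q n =
           vmax (d (n+3) + d (n+4) + d (n+5) + d (n+6)) (r n + p (n+1))"
    and "\<And>n. r (n+1) + r n =
           vmax (d (n+4) + 2 *s d (n+5) + d (n+6)) (v n + j n + q (n+1))"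
    and "\<And>n. v (n+1) + j n = vmax (d (n+5) + d (n+6)) (r (n+1))"
    and "\<And>n. j (n+1) + v n = vmax (d (n+5) + d (n+6)) (r (n+1))"
    and "transpose (vector [r 0, v 0, j 0, d 0, d 1, d 2, d 3, d 4, d 5, d 6, p 0, q 0]
           :: int ^ 12 ^ 12) = - mat 1"
    and "a = vector [2, 1, 1, 1, 1, 1, 1, 1, 1, 1, 2, 2]"
  shows "(\<forall>w \<in> {d, p, q, r, v, j}. \<forall>n.
            shift_pow_minus_1 6 (shift_pow_minus_1 5 (shift_pow_minus_1 1 w)) n = 0) \<and>
         (\<forall>w \<in> {d, v, j}. \<forall>i.
            (\<lambda>n. real_of_int (w n $ i) - (real n)\<^sup>2 / 60 * a $ i) \<in> O(\<lambda>n. real n)) \<and>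
         (\<forall>w \<in> {p, q, r}. \<forall>i.
            (\<lambda>n. real_of_int (w n $ i) - (real n)\<^sup>2 / 30 * a $ i) \<in> O(\<lambda>n. real n))"
proof -
  define K :: "int ^ 12" where "K = vector [2, 1, 1, 1, 1, 1, 1, 1, 1, 1, 2, 2]"
  have a_K: "a $ i = real_of_int (K $ i)" for i
  proof -
    have "\<forall>i. a $ i = real_of_int (K $ i)"
      unfolding forall_12 assms(8) K_def vector_12 by simp
    then show ?thesis ..
  qed
  define M :: "int ^ 12 ^ 12"
    where "M = vector [r 0, v 0, j 0, d 0, d 1, d 2, d 3, d 4, d 5, d 6, p 0, q 0]"
  \<comment> \<open>The rows of \<open>M\<close> are the initial vectors, so row \<open>k\<close> is
    minus the \<open>k\<close>-th unit vector.\<close>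
  have M: "M $ k $ i = (if i = k then - 1 else 0)" for i k
  proof -
    have "M $ k $ i = transpose M $ i $ k" by (simp add: transpose_def)
    also have "\<dots> = (if i = k then - 1 else 0)"
      unfolding M_def assms(7) by (simp add: mat_def)
    finally show ?thesis .
  qed
  have rows: "M $ 1 = r 0" "M $ 2 = v 0" "M $ 3 = j 0" "M $ 4 = d 0" "M $ 5 = d 1" "M $ 6 = d 2"
    "M $ 7 = d 3" "M $ 8 = d 4" "M $ 9 = d 5" "M $ 10 = d 6" "M $ 11 = p 0" "M $ 12 = q 0"
    unfolding M_def vector_12 by (rule refl)+
  \<comment> \<open>Both \<open>vmax\<close> and the linear operations act componentwise, so each
    coordinate evolves by its own scalar system.\<close>
  have sys: "tropical_D6 (\<lambda>n. d n $ i) (\<lambda>n. p n $ i) (\<lambda>n. q n $ i) (\<lambda>n. r n $ i)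
      (\<lambda>n. v n $ i) (\<lambda>n. j n $ i)" for i
    by unfold_locales
      (use assms(1-6) [THEN arg_cong[where f = "\<lambda>x. x $ i"]] in \<open>simp_all add: vmax_def\<close>)
  \<comment> \<open>In coordinate \<open>i\<close> only the \<open>i\<close>-th of the twelve
    initial values is nonzero, which is the \<open>i\<close>-th case of
    \<open>good_y_unit\<close>.\<close>
  have "\<forall>i. good_y (yinit (r 0 $ i) (v 0 $ i) (j 0 $ i) (d 0 $ i) (d 1 $ i) (d 2 $ i) (d 3 $ i)
      (d 4 $ i) (d 5 $ i) (d 6 $ i) (p 0 $ i) (q 0 $ i)) (K $ i)"
    unfolding forall_12 rows[symmetric] M K_def vector_12 using good_y_unit by simp
  then have good: "good_y (tropical_D6.y (\<lambda>n. d n $ i) (\<lambda>n. p n $ i) (\<lambda>n. q n $ i)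
      (\<lambda>n. r n $ i) (\<lambda>n. v n $ i) (\<lambda>n. j n $ i) 0) (K $ i)" for i
    by (simp only: tropical_D6.y_0[OF sys])
  note diff65_coord = tropical_D6.diff65_d[OF sys good] tropical_D6.diff65_v_j[OF sys good]
    tropical_D6.diff65_p[OF sys good] tropical_D6.diff65_q[OF sys good]
    tropical_D6.diff65_r[OF sys good]
  have diff65_vec: "diff65 w n $ i = diff65 (\<lambda>n. w n $ i) n" for w :: "nat \<Rightarrow> int ^ 12" and n i
    by (simp add: diff65_def)
  have "shift_pow_minus_1 6 (shift_pow_minus_1 5 (shift_pow_minus_1 1 w)) n = 0"
    if "w \<in> {d, p, q, r, v, j}" for w n
    using that unfolding shift_pow_minus_1_diff65
    by (auto simp: vec_eq_iff diff65_vec diff65_coord)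
  moreover have "(\<lambda>n. real_of_int (w n $ i) - (real n)\<^sup>2 / 60 * a $ i) \<in> O(\<lambda>n. real n)"
    if "w \<in> {d, v, j}" for w i
    unfolding a_K using that diff65_coord by (intro diff65_const_asymptotics) auto
  moreover have "(\<lambda>n. real_of_int (w n $ i) - (real n)\<^sup>2 / 30 * a $ i) \<in> O(\<lambda>n. real n)"
    if "w \<in> {p, q, r}" for w i
  proof -
    \<comment> \<open>Here the second difference is \<open>2 * K\<close>, which doubles the leading
      coefficient from 1/60 to 1/30.\<close>
    have "(\<lambda>n. real_of_int (w n $ i) - (real n)\<^sup>2 / 60 * real_of_int (2 * K $ i)) \<in> O(\<lambda>n. real n)"
      using that diff65_coord by (intro diff65_const_asymptotics) auto
    moreover have "x / 60 * real_of_int (2 * k) = x / 30 * real_of_int k" for x k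
      by simp
    ultimately show ?thesis unfolding a_K by (simp only:)
  qed
  ultimately show ?thesis by blast
qed

end
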